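(* Let $\mathcal L$, $X$, $Y$ satisfy the standing assumptions listed in the context (in particular $Y$ is $\alpha$-strongly convex with $\alpha>0$), and suppose that for some $\tilde\mu>0$ the function $\mathcal L(x,\cdot)$ is $\tilde\mu$-strongly concave for every $x\in X$, with $L_{yy}>0$. Let $x_0\in X$, $y_0\in Y$, let $c\in(0,1]$ be fixed, and for each number of iterations $K$ let $\{(x_k,y_k)\}_{k\ge0}$ be generated by the algorithm described in the context (R-PDCG with $\mu=0$) with primal step-sizes $\tau_k=cK^{-3/4}$ for all $k$ and dual step-sizes $$\sigma_k=\min\Big\{1,\ \frac{\alpha}{4L_{yy}}\|\nabla_y\mathcal L(x_k,y_k)\|_{\mathcal Y^*}\Big\}.$$ Then there is a constant $C>0$, depending only on $c$ and on the problem instance (the function $\mathcal L$, the sets $X,Y$, the norms, the constants in the assumptions, and $x_0,y_0$) but not on $K$ or $\epsilon$, such that: (i) for every integer $K\ge2$ there exists $t\in\{\lceil K/2\rceil,\dots,K-1\}$ such that $(x_t,y_t)\in X\times Y$ satisfies $\mathcal G_X(x_t,y_t)\le CK^{-1/4}$ and $\mathcal G_Y(x_t,y_t)\le CK^{-1/2}$; (ii) for every $\epsilon\in(0,1)$, running the algorithm with $K=\lceil C\epsilon^{-4}\rceil$ yields such a $t$ with $\mathcal G_X(x_t,y_t)\le\epsilon$, and running it with $K=\lceil C\epsilon^{-2}\rceil$ yields such a $t$ with $\mathcal G_Y(x_t,y_t)\le\epsilon$; i.e., the $\epsilon$-primal gap is achieved within $O(\epsilon^{-4})$ iterations and the $\epsilon$-dual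 gap within $O(\epsilon^{-2})$ iterations.
   Context: Setting. $(\mathcal X,\|\cdot\|_{\mathcal X})$ and $(\mathcal Y,\|\cdot\|_{\mathcal Y})$ are finite-dimensional real normed spaces with dual norms $\|\cdot\|_{\mathcal X^*}$, $\|\cdot\|_{\mathcal Y^*}$. The problem is $\min_{x\in X}\max_{y\in Y}\mathcal L(x,y)$ with $\mathcal L:\mathcal X\times\mathcal Y\to\mathbb R$. Standing assumptions. (I) For every $y\in Y$, $\mathcal L(\cdot,y)$ (possibly nonconvex) is continuously differentiable, and there are $L_{xx}\ge0$, $L_{yx}>0$ with $\|\nabla_x\mathcal L(x,y)-\nabla_x\mathcal L(\bar x,\bar y)\|_{\mathcal X^*}\le L_{xx}\|x-\bar x\|_{\mathcal X}+L_{yx}\|y-\bar y\|_{\mathcal Y}$ for all $x,\bar x\in X$, $y,\bar y\in Y$. (II) For every $x\in X$, $\mathcal L(x,\cdot)$ is concave and continuously differentiable, and there is $L_{yy}\ge0$ with $\|\nabla_y\mathcal L(x,y)-\nabla_y\mathcal L(\bar x,\bar y)\|_{\mathcal Y^*}\le L_{yx}\|x-\bar x\|_{\mathcal X}+L_{yy}\|y-\bar y\|_{\mathcal Y}$ for all $x,\bar x\in X$, $y,\bar y\in Y$. (III) $X\subseteq\mathcal X$, $Y\subseteq\mathcal Y$ are (nonempty) convex compact sets. (IV) $Y$ is $\alpha$-strongly convex for some $\alpha>0$: for all $u,v\in Y$, $\gamma\in[0,1]$ and $w\in\mathcal Y$ with $\|w\|_{\mathcal Y}=1$, $\gamma u+(1-\gamma)v+\gamma(1-\gamma)\frac{\alpha}{2}\|u-v\|_{\mathcal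 Y}^2w\in Y$. $\mathcal L(x,\cdot)$ being $\tilde\mu$-strongly concave means $\mathcal L(x,y')\le\mathcal L(x,y)+\langle\nabla_y\mathcal L(x,y),y'-y\rangle-\frac{\tilde\mu}{2}\|y'-y\|_{\mathcal Y}^2$ for all $y,y'\in Y$. Gap functions: $\mathcal G_X(\bar x,\bar y)=\sup_{x\in X}\langle\nabla_x\mathcal L(\bar x,\bar y),\bar x-x\rangle$, $\mathcal G_Y(\bar x,\bar y)=\sup_{y\in Y}\langle\nabla_y\mathcal L(\bar x,\bar y),y-\bar y\rangle$. Algorithm (R-PDCG with $\mu=0$). Given $x_0\in X$, $y_0\in Y$ and step-sizes $\tau_k,\sigma_k$, for $k=0,1,\dots$: $s_k\in\operatorname{argmin}_{x\in X}\langle\nabla_x\mathcal L(x_k,y_k),x\rangle$; $x_{k+1}=\tau_ks_k+(1-\tau_k)x_k$; $p_k\in\operatorname{argmax}_{y\in Y}\langle\nabla_y\mathcal L(x_k,y_k),y\rangle$; $y_{k+1}=\sigma_kp_k+(1-\sigma_k)y_k$ (arbitrary selections of minimizers/maximizers). *)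

theory Defs
  imports "HOL-Analysis.Analysis"
begin

text \<open>
  The norms are arbitrary, so the spaces are of class \<open>real_normed_vector\<close> with the property
  below rather than of class \<open>euclidean_space\<close>, which fixes the norm of an inner product.
\<close>

definition finite_dimensional :: "'a::real_normed_vector itself \<Rightarrow> bool" where
  "finite_dimensional _ \<longleftrightarrow> (\<exists>B::'a set. finite B \<and> span B = UNIV)"

text \<open>
  The gradient is an element of the dual space \<open>'a \<Rightarrow>\<^sub>L real\<close>: the pairing with a vector is
  application, and the norm of that type (the operator norm) is the dual norm.
  Where \<open>f\<close> is not differentiable the value carries no meaning.
\<close>

definition gradient :: "('a::real_normed_vector \<Rightarrow> real) \<Rightarrow> 'a \<Rightarrow> 'a \<Rightarrow>\<^sub>L real" where
  "gradient f x = Blinfun (frechet_derivative f (at x))"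

definition continuously_differentiable :: "('a::real_normed_vector \<Rightarrow> real) \<Rightarrow> bool" where
  "continuously_differentiable f \<longleftrightarrow>
     (\<forall>x. f differentiable (at x)) \<and> continuous_on UNIV (gradient f)"

definition grad_x ::
    "('a::real_normed_vector \<Rightarrow> 'b::real_normed_vector \<Rightarrow> real) \<Rightarrow> 'a \<Rightarrow> 'b \<Rightarrow> 'a \<Rightarrow>\<^sub>L real" where
  "grad_x L x y = gradient (\<lambda>u. L u y) x"

definition grad_y ::
    "('a::real_normed_vector \<Rightarrow> 'b::real_normed_vector \<Rightarrow> real) \<Rightarrow> 'a \<Rightarrow> 'b \<Rightarrow> 'b \<Rightarrow>\<^sub>L real" where
  "grad_y L x y = gradient (\<lambda>v. L x v) y"

definition strongly_convex_set :: "real \<Rightarrow> 'a::real_normed_vector set \<Rightarrow> bool" where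
  "strongly_convex_set \<alpha> S \<longleftrightarrow>
     (\<forall>u\<in>S. \<forall>v\<in>S. \<forall>\<gamma>\<in>{0..1}. \<forall>w. norm w = 1 \<longrightarrow>
        \<gamma> *\<^sub>R u + (1 - \<gamma>) *\<^sub>R v + (\<gamma> * (1 - \<gamma>) * (\<alpha> / 2) * (norm (u - v))\<^sup>2) *\<^sub>R w \<in> S)"

definition strongly_concave_on ::
    "real \<Rightarrow> 'a::real_normed_vector set \<Rightarrow> ('a \<Rightarrow> real) \<Rightarrow> bool" where
  "strongly_concave_on \<mu> S f \<longleftrightarrow>
     (\<forall>u\<in>S. \<forall>v\<in>S. f v \<le> f u + gradient f u (v - u) - \<mu> / 2 * (norm (v - u))\<^sup>2)"

definition gap_X ::
    "('a::real_normed_vector \<Rightarrow> 'b::real_normed_vector \<Rightarrow> real) \<Rightarrow> 'a set \<Rightarrow> 'a \<Rightarrow> 'b \<Rightarrow> real" where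
  "gap_X L X x y = (SUP u\<in>X. grad_x L x y (x - u))"

definition gap_Y ::
    "('a::real_normed_vector \<Rightarrow> 'b::real_normed_vector \<Rightarrow> real) \<Rightarrow> 'b set \<Rightarrow> 'a \<Rightarrow> 'b \<Rightarrow> real" where
  "gap_Y L Y x y = (SUP v\<in>Y. grad_y L x y (v - y))"

text \<open>
  The sequences \<open>x\<close>, \<open>y\<close> are produced by the algorithm for some selection of the minimizers \<open>s k\<close>
  and maximizers \<open>p k\<close>.
\<close>

definition rpdcg ::
    "('a::real_normed_vector \<Rightarrow> 'b::real_normed_vector \<Rightarrow> real) \<Rightarrow> 'a set \<Rightarrow> 'b set \<Rightarrow> 'a \<Rightarrow> 'b
      \<Rightarrow> (nat \<Rightarrow> real) \<Rightarrow> (nat \<Rightarrow> real) \<Rightarrow> (nat \<Rightarrow> 'a) \<Rightarrow> (nat \<Rightarrow> 'b) \<Rightarrow> bool" where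
  "rpdcg L X Y x0 y0 \<tau> \<sigma> x y \<longleftrightarrow>
     x 0 = x0 \<and> y 0 = y0 \<and>
     (\<exists>s p. \<forall>k.
        is_arg_min (\<lambda>u. grad_x L (x k) (y k) u) (\<lambda>u. u \<in> X) (s k) \<and>
        x (Suc k) = \<tau> k *\<^sub>R s k + (1 - \<tau> k) *\<^sub>R x k \<and>
        is_arg_max (\<lambda>v. grad_y L (x k) (y k) v) (\<lambda>v. v \<in> Y) (p k) \<and>
        y (Suc k) = \<sigma> k *\<^sub>R p k + (1 - \<sigma> k) *\<^sub>R y k)"

definition rpdcg_run ::
    "('a::real_normed_vector \<Rightarrow> 'b::real_normed_vector \<Rightarrow> real) \<Rightarrow> 'a set \<Rightarrow> 'b set \<Rightarrow> 'a \<Rightarrow> 'b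
      \<Rightarrow> real \<Rightarrow> real \<Rightarrow> real \<Rightarrow> nat \<Rightarrow> (nat \<Rightarrow> 'a) \<Rightarrow> (nat \<Rightarrow> 'b) \<Rightarrow> bool" where
  "rpdcg_run L X Y x0 y0 \<alpha> Lyy c K x y \<longleftrightarrow>
     rpdcg L X Y x0 y0
       (\<lambda>k. c * real K powr (-3/4))
       (\<lambda>k. min 1 (\<alpha> / (4 * Lyy) * norm (grad_y L (x k) (y k))))
       x y"

end

theory Submission
  imports Defs
begin

text \<open>
  Let \<open>\<phi> x = max L x\<close> over \<open>Y\<close> and \<open>h x y = \<phi> x - L x y\<close>. Strong convexity of \<open>Y\<close> makes the
  dual step decrease \<open>h\<close> by at least half of \<open>\<sigma>\<close> times the dual gap, and strong concavity bounds
  \<open>\<sigma>\<close> below by a multiple of \<open>sqrt h\<close>; the primal step increases \<open>h\<close> by at most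
  \<open>O(\<tau> sqrt h + \<tau>\<^sup>2)\<close>. Hence \<open>r = sqrt h\<close> obeys \<open>r\<^sub>k\<^sub>+\<^sub>1 \<le> r\<^sub>k - b r\<^sub>k\<^sup>2 + E \<tau>\<close>, which forces
  \<open>r = O(K\<^sup>-\<^sup>1\<^sup>/\<^sup>4)\<close> from iteration \<open>K/2\<close> on. From then on the potential \<open>h + \<phi>\<close> drops in each
  iteration by \<open>\<sigma>/2\<close> times the dual gap plus \<open>\<tau>\<close> times the primal gap, up to an error \<open>O(1/K)\<close>.
  Averaging gives one iterate at which both products are \<open>O(1/K)\<close>; since \<open>\<sigma>\<close> is at least
  a multiple of the dual gap, the dual gap squared is \<open>O(1/K)\<close>.
\<close>

section \<open>Smooth functions, and linear maximization over strongly convex sets\<close>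

lemma has_derivative_gradient:
  assumes "f differentiable (at x)"
  shows "(f has_derivative blinfun_apply (gradient f x)) (at x)"
proof -
  have "(f has_derivative frechet_derivative f (at x)) (at x)"
    using assms frechet_derivative_works by blast
  then show ?thesis
    using has_derivative_bounded_linear[of f "frechet_derivative f (at x)" "at x"]
    by (simp add: gradient_def bounded_linear_Blinfun_apply)
qed

text \<open>The Lipschitz condition is relative to \<open>u\<close> and confined to
  \<open>S\<close>, since gradients are controlled on the feasible sets only. Along the segment it
  bounds the derivative of the first-order remainder; monotonicity of the remainder plus or minus a
  quadratic in \<open>t\<close> then takes the place of integration.\<close>

lemma descent_lemma:
  fixes f :: "'a::real_normed_vector \<Rightarrow> real"
  assumes "convex S" "u \<in> S" "v \<in> S"
    and diff: "\<And>z. f differentiable (at z)"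
    and lip: "\<And>z. z \<in> S \<Longrightarrow> norm (gradient f z - gradient f u) \<le> l * norm (z - u)"
  shows "\<bar>f v - f u - gradient f u (v - u)\<bar> \<le> l / 2 * (norm (v - u))\<^sup>2"
proof -
  define d where "d = v - u"
  define \<psi> where "\<psi> t = f (u + t *\<^sub>R d) - f u - t * gradient f u d" for t
  define \<psi>' where "\<psi>' t = gradient f (u + t *\<^sub>R d) d - gradient f u d" for t
  have der: "(\<psi> has_real_derivative \<psi>' t) (at t)" for t
  proof -
    have "((\<lambda>t. f (u + t *\<^sub>R d)) has_derivative
        (\<lambda>s. gradient f (u + t *\<^sub>R d) (s *\<^sub>R d))) (at t)"
      by (rule has_derivative_compose[where f = "\<lambda>t. u + t *\<^sub>R d", OF _ has_derivative_gradient[OF diff]])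
        (auto intro!: derivative_eq_intros)
    then have "((\<lambda>t. f (u + t *\<^sub>R d)) has_real_derivative gradient f (u + t *\<^sub>R d) d) (at t)"
      by (simp add: has_field_derivative_def blinfun.scaleR_right mult_commute_abs)
    then show ?thesis
      unfolding \<psi>_def[abs_def] \<psi>'_def by (auto intro!: derivative_eq_intros)
  qed
  have bd: "\<bar>\<psi>' t\<bar> \<le> l * t * (norm d)\<^sup>2" if "0 \<le> t" "t \<le> 1" for t
  proof -
    have "u + t *\<^sub>R d = (1 - t) *\<^sub>R u + t *\<^sub>R v"
      by (simp add: d_def algebra_simps)
    then have "u + t *\<^sub>R d \<in> S"
      using convexD_alt[OF \<open>convex S\<close>, of u v t] assms that by simp
    from lip[OF this] have "norm (gradient f (u + t *\<^sub>R d) - gradient f u) \<le> l * (t * norm d)"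
      using that by simp
    then have "norm (gradient f (u + t *\<^sub>R d) - gradient f u) * norm d \<le> l * (t * norm d) * norm d"
      by (rule mult_right_mono) simp
    moreover have "\<psi>' t = (gradient f (u + t *\<^sub>R d) - gradient f u) d"
      by (simp add: \<psi>'_def blinfun.diff_left)
    ultimately show ?thesis
      using norm_blinfun[of "gradient f (u + t *\<^sub>R d) - gradient f u" d]
      by (simp add: power2_eq_square algebra_simps)
  qed
  have "\<psi> 1 - l / 2 * 1\<^sup>2 * (norm d)\<^sup>2 \<le> \<psi> 0 - l / 2 * 0\<^sup>2 * (norm d)\<^sup>2"
  proof (rule DERIV_nonpos_imp_nonincreasing[where f = "\<lambda>t. \<psi> t - l / 2 * t\<^sup>2 * (norm d)\<^sup>2"])
    fix t :: real assume "0 \<le> t" "t \<le> 1"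
    moreover have "((\<lambda>t. \<psi> t - l / 2 * t\<^sup>2 * (norm d)\<^sup>2) has_real_derivative
        (\<psi>' t - l * t * (norm d)\<^sup>2)) (at t)"
      by (auto intro!: derivative_eq_intros der)
    ultimately show "\<exists>y. ((\<lambda>t. \<psi> t - l / 2 * t\<^sup>2 * (norm d)\<^sup>2) has_real_derivative y) (at t) \<and> y \<le> 0"
      using bd[of t] by (intro exI[of _ "\<psi>' t - l * t * (norm d)\<^sup>2"]) auto
  qed simp
  moreover have "\<psi> 0 + l / 2 * 0\<^sup>2 * (norm d)\<^sup>2 \<le> \<psi> 1 + l / 2 * 1\<^sup>2 * (norm d)\<^sup>2"
  proof (rule DERIV_nonneg_imp_nondecreasing[where f = "\<lambda>t. \<psi> t + l / 2 * t\<^sup>2 * (norm d)\<^sup>2"])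
    fix t :: real assume "0 \<le> t" "t \<le> 1"
    moreover have "((\<lambda>t. \<psi> t + l / 2 * t\<^sup>2 * (norm d)\<^sup>2) has_real_derivative
        (\<psi>' t + l * t * (norm d)\<^sup>2)) (at t)"
      by (auto intro!: derivative_eq_intros der)
    ultimately show "\<exists>y. ((\<lambda>t. \<psi> t + l / 2 * t\<^sup>2 * (norm d)\<^sup>2) has_real_derivative y) (at t) \<and> 0 \<le> y"
      using bd[of t] by (intro exI[of _ "\<psi>' t + l * t * (norm d)\<^sup>2"]) auto
  qed simp
  ultimately show ?thesis
    unfolding abs_le_iff by (auto simp: \<psi>_def d_def)
qed

text \<open>Strong convexity puts into \<open>S\<close> a sphere of radius
  \<open>\<alpha> / 8 * (norm (p - y))\<^sup>2\<close> around the midpoint of \<open>p\<close> and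
  \<open>y\<close>. Maximality of \<open>p\<close> against its points bounds \<open>g\<close> in
  every unit direction, hence its dual norm.\<close>

lemma strongly_convex_set_linear_gap:
  fixes g :: "'a::real_normed_vector \<Rightarrow>\<^sub>L real"
  assumes S: "strongly_convex_set \<alpha> S" and "\<alpha> > 0" "p \<in> S" "y \<in> S"
    and max: "\<And>v. v \<in> S \<Longrightarrow> g v \<le> g p"
  shows "\<alpha> / 4 * norm g * (norm (p - y))\<^sup>2 \<le> g (p - y)"
proof (cases "p = y")
  case False
  define D where "D = \<alpha> / 4 * (norm (p - y))\<^sup>2"
  have "D > 0"
    using False \<open>\<alpha> > 0\<close> by (simp add: D_def)
  have unit: "D * g w \<le> g (p - y)" if "norm w = 1" for w
  proof -
    have "(1/2) *\<^sub>R p + (1 - 1/2) *\<^sub>R y + (1/2 * (1 - 1/2) * (\<alpha> / 2) * (norm (p - y))\<^sup>2) *\<^sub>R w \<in> S"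
      by (rule S[unfolded strongly_convex_set_def, rule_format, OF \<open>p \<in> S\<close> \<open>y \<in> S\<close> _ that]) simp
    from max[OF this] show ?thesis
      by (simp add: blinfun.add_right blinfun.scaleR_right blinfun.diff_right D_def algebra_simps)
  qed
  have "norm g \<le> g (p - y) / D"
  proof (rule norm_blinfun_bound)
    show "0 \<le> g (p - y) / D"
      using max[OF \<open>y \<in> S\<close>] \<open>D > 0\<close> by (simp add: blinfun.diff_right)
    fix v
    show "norm (g v) \<le> g (p - y) / D * norm v"
    proof (cases "v = 0")
      case False
      have "D * (g v / norm v) \<le> g (p - y)" "D * (- g v / norm v) \<le> g (p - y)"
        using unit[of "v /\<^sub>R norm v"] unit[of "(- v) /\<^sub>R norm v"] False
        by (simp_all add: blinfun.scaleR_right blinfun.minus_right divide_inverse mult.commute)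
      then show ?thesis
        using \<open>D > 0\<close> False by (simp add: field_simps abs_le_iff)
    qed simp
  qed
  then show ?thesis
    using \<open>D > 0\<close> by (simp add: D_def field_simps)
qed simp

section \<open>Scalar recursions and uniform bounds\<close>

lemma quadratic_drift_bound:
  fixes r :: "nat \<Rightarrow> real"
  assumes nonneg: "\<And>k. 0 \<le> r k" and "r 0 \<le> R"
    and step: "\<And>k. r (Suc k) \<le> r k - b * (r k)\<^sup>2 + e"
    and "0 \<le> b" "0 \<le> \<rho>" "0 \<le> e" "e \<le> b * \<rho>\<^sup>2" and m: "R < real m * (b * \<rho>\<^sup>2 - e)"
    and "m \<le> k"
  shows "r k \<le> \<rho> + e"
proof -
  \<comment> \<open>Above the level \<open>\<rho>\<close> every step loses at least
    \<open>b * \<rho>\<^sup>2 - e\<close>; never reaching the level would therefore make the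
    sequence negative within \<open>m\<close> steps.\<close>
  have dec: "r (Suc j) \<le> r j - (b * \<rho>\<^sup>2 - e)" if "\<rho> < r j" for j
  proof -
    have "\<rho>\<^sup>2 \<le> (r j)\<^sup>2"
      using that \<open>0 \<le> \<rho>\<close> by (intro power_mono) auto
    then show ?thesis
      using step[of j] mult_left_mono[OF _ \<open>0 \<le> b\<close>] by fastforce
  qed
  obtain j where "j < m" "r j \<le> \<rho>"
  proof -
    have "\<exists>j<m. r j \<le> \<rho>"
    proof (rule ccontr)
      assume *: "\<not> (\<exists>j<m. r j \<le> \<rho>)"
      have "r i \<le> R - real i * (b * \<rho>\<^sup>2 - e)" if "i \<le> m" for i
        using that
      proof (induction i)
        case (Suc i)
        then show ?case
          using dec[of i] * by (auto simp: not_le algebra_simps)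
      qed (use \<open>r 0 \<le> R\<close> in simp)
      from this[of m] m nonneg[of m] show False by simp
    qed
    then show ?thesis using that by blast
  qed
  \<comment> \<open>After this visit the level is overshot by at most \<open>e\<close>: from below a
    step adds at most \<open>e\<close>, and from above the sequence does not increase.\<close>
  have "j \<le> k"
    using \<open>j < m\<close> \<open>m \<le> k\<close> by simp
  then show ?thesis
  proof (induction k rule: dec_induct)
    case base
    then show ?case using \<open>r j \<le> \<rho>\<close> \<open>0 \<le> e\<close> by simp
  next
    case (step n)
    have "0 \<le> b * (r n)\<^sup>2"
      using \<open>0 \<le> b\<close> by simp
    then show ?case
      using dec[of n] assms(3)[of n] step.IH \<open>e \<le> b * \<rho>\<^sup>2\<close> by (cases "\<rho> < r n") auto
  qed
qed

text \<open>With \<open>z\<close> a sum of two nonnegative terms this yields a single index at which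
  both are small; averaging them separately could give two different indices.\<close>

lemma telescoping_average:
  fixes \<Psi> z :: "nat \<Rightarrow> real"
  assumes step: "\<And>k. m \<le> k \<Longrightarrow> \<Psi> (Suc k) \<le> \<Psi> k - z k + n" and "m < K"
  obtains t where "t \<in> {m..K - 1}" "real (K - m) * z t \<le> \<Psi> m - \<Psi> K + real (K - m) * n"
proof -
  have sum: "\<Psi> j - \<Psi> m + (\<Sum>k=m..<j. z k) \<le> real (j - m) * n" if "m \<le> j" for j
    using that
  proof (induction j rule: dec_induct)
    case (step j)
    then show ?case
      using assms(1)[of j] by (simp add: Suc_diff_le algebra_simps)
  qed simp
  have "\<exists>t\<in>{m..K - 1}. real (K - m) * z t \<le> \<Psi> m - \<Psi> K + real (K - m) * n"
  proof (rule ccontr)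
    assume *: "\<not> (\<exists>t\<in>{m..K - 1}. real (K - m) * z t \<le> \<Psi> m - \<Psi> K + real (K - m) * n)"
    define B where "B = (\<Psi> m - \<Psi> K + real (K - m) * n) / real (K - m)"
    have "B < z k" if "k \<in> {m..<K}" for k
      using * that \<open>m < K\<close> unfolding B_def
      by (force simp: pos_divide_less_eq mult.commute)
    then have "(\<Sum>k=m..<K. B) < (\<Sum>k=m..<K. z k)"
      using \<open>m < K\<close> by (intro sum_strict_mono) auto
    moreover have "(\<Sum>k=m..<K. B) = \<Psi> m - \<Psi> K + real (K - m) * n"
      using \<open>m < K\<close> by (simp add: B_def)
    ultimately show False
      using sum[of K] \<open>m < K\<close> by simp
  qed
  then show ?thesis using that by blast
qed

text \<open>Comparison with one fixed pair of points and the diameters gives the bound. Positivity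
  of \<open>M\<close> permits division by it even if \<open>F\<close> vanishes.\<close>

lemma lipschitz_product_bounded:
  fixes F :: "'a::metric_space \<Rightarrow> 'b::metric_space \<Rightarrow> 'c::real_normed_vector"
  assumes "bounded S" "bounded T" "0 \<le> a" "0 \<le> b"
    and lip: "\<And>x x' y y'. x \<in> S \<Longrightarrow> x' \<in> S \<Longrightarrow> y \<in> T \<Longrightarrow> y' \<in> T \<Longrightarrow>
           norm (F x y - F x' y') \<le> a * dist x x' + b * dist y y'"
  obtains M where "M > 0" "\<And>x y. x \<in> S \<Longrightarrow> y \<in> T \<Longrightarrow> norm (F x y) \<le> M"
proof (cases "S = {} \<or> T = {}")
  case False
  then obtain x1 y1 where 1: "x1 \<in> S" "y1 \<in> T"
    by blast
  define M where "M = norm (F x1 y1) + a * diameter S + b * diameter T + 1"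
  have bd: "norm (F x y) \<le> M - 1" if "x \<in> S" "y \<in> T" for x y
  proof -
    have "a * dist x x1 \<le> a * diameter S" "b * dist y y1 \<le> b * diameter T"
      using assms that 1 by (auto intro!: mult_left_mono diameter_bounded_bound)
    then show ?thesis
      using lip[OF that(1) 1(1) that(2) 1(2)] norm_triangle_sub[of "F x y" "F x1 y1"]
      by (simp add: M_def)
  qed
  have "0 \<le> M - 1"
    using bd[OF 1] norm_ge_zero order_trans by blast
  then show ?thesis
    using bd by (intro that[of M]) force+
qed (use that[of 1] in auto)

section \<open>The primal function and the suboptimality of the dual variable\<close>

locale saddle =
  fixes L :: "'a::real_normed_vector \<Rightarrow> 'b::real_normed_vector \<Rightarrow> real"
    and X :: "'a set" and Y :: "'b set"
    and Lxx Lyx Lyy \<alpha> \<mu> :: real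
  assumes Lxx: "Lxx \<ge> 0" and Lyx: "Lyx > 0" and Lyy: "Lyy > 0"
    and diff_x: "\<And>x y. y \<in> Y \<Longrightarrow> (\<lambda>u. L u y) differentiable (at x)"
    and lip_x: "\<And>x x' y y'. x \<in> X \<Longrightarrow> x' \<in> X \<Longrightarrow> y \<in> Y \<Longrightarrow> y' \<in> Y \<Longrightarrow>
           norm (grad_x L x y - grad_x L x' y') \<le> Lxx * norm (x - x') + Lyx * norm (y - y')"
    and diff_y: "\<And>x y. x \<in> X \<Longrightarrow> (\<lambda>v. L x v) differentiable (at y)"
    and lip_y: "\<And>x x' y y'. x \<in> X \<Longrightarrow> x' \<in> X \<Longrightarrow> y \<in> Y \<Longrightarrow> y' \<in> Y \<Longrightarrow>
           norm (grad_y L x y - grad_y L x' y') \<le> Lyx * norm (x - x') + Lyy * norm (y - y')"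
    and convex_X: "convex X" and compact_X: "compact X"
    and Y_nonempty: "Y \<noteq> {}" and convex_Y: "convex Y" and compact_Y: "compact Y"
    and \<alpha>: "\<alpha> > 0" and strongly_convex: "strongly_convex_set \<alpha> Y"
    and \<mu>: "\<mu> > 0" and strongly_concave: "\<And>x. x \<in> X \<Longrightarrow> strongly_concave_on \<mu> Y (\<lambda>y. L x y)"
begin

definition \<phi> :: "'a \<Rightarrow> real" where
  "\<phi> x = (SUP y\<in>Y. L x y)"

definition h :: "'a \<Rightarrow> 'b \<Rightarrow> real" where
  "h x y = \<phi> x - L x y"

definition \<kappa> :: real where
  "\<kappa> = 2 * Lyx / sqrt \<mu>"

text \<open>Of the summand \<open>Lxx\<close>, one half pays for the smoothness error of \<phi> and
  the other for that of \<open>L\<close> with \<open>y\<close> fixed;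
  \<open>Lyx\<^sup>2 / \<mu>\<close> pays for the moving maximizer.\<close>

definition \<beta> :: real where
  "\<beta> = Lxx + Lyx\<^sup>2 / \<mu>"

lemma \<kappa>_nonneg: "\<kappa> \<ge> 0" and \<beta>_nonneg: "\<beta> \<ge> 0"
  using Lxx Lyx \<mu> by (auto simp: \<kappa>_def \<beta>_def)

lemma strong_concavity:
  assumes "x \<in> X" "u \<in> Y" "v \<in> Y"
  shows "L x v \<le> L x u + grad_y L x u (v - u) - \<mu> / 2 * (norm (v - u))\<^sup>2"
  using strongly_concave[OF assms(1)] assms(2,3) by (simp add: strongly_concave_on_def grad_y_def)

lemma maximizer:
  assumes "x \<in> X"
  obtains ym where "ym \<in> Y" "\<phi> x = L x ym" "\<And>v. v \<in> Y \<Longrightarrow> L x v \<le> \<phi> x"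
proof -
  have "continuous_on Y (L x)"
    using diff_y[OF assms] differentiable_imp_continuous_within
    by (intro continuous_at_imp_continuous_on) auto
  then obtain ym where "ym \<in> Y" "\<And>v. v \<in> Y \<Longrightarrow> L x v \<le> L x ym"
    using continuous_attains_sup[OF compact_Y Y_nonempty] by blast
  moreover from this have "\<phi> x = L x ym"
    unfolding \<phi>_def by (intro cSup_eq_maximum) auto
  ultimately show ?thesis using that by simp
qed

lemma h_nonneg: "x \<in> X \<Longrightarrow> y \<in> Y \<Longrightarrow> 0 \<le> h x y"
  by (metis h_def diff_ge_0_iff_ge maximizer)

text \<open>
  Strong concavity at the midpoint of \<open>y\<close> and the maximizer avoids the first-order optimality
  condition, at the price of the constant \<open>\<mu> / 4\<close> in place of \<open>\<mu> / 2\<close>.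
\<close>

lemma quadratic_growth:
  assumes "x \<in> X" "y \<in> Y" "ym \<in> Y" "\<phi> x = L x ym"
  shows "\<mu> / 4 * (norm (ym - y))\<^sup>2 \<le> h x y"
proof -
  define z where "z = (1/2) *\<^sub>R y + (1/2) *\<^sub>R ym"
  have "z \<in> Y"
    using convexD[OF convex_Y assms(2,3), of "1/2" "1/2"] by (simp add: z_def)
  have 1: "ym - z = (1/2) *\<^sub>R (ym - y)" "y - z = - ((1/2) *\<^sub>R (ym - y))"
    unfolding z_def by (simp_all add: algebra_simps flip: scaleR_add_left)
  have "L x z \<le> \<phi> x"
    by (rule maximizer[OF assms(1)]) (use \<open>z \<in> Y\<close> in blast)
  with strong_concavity[OF assms(1) \<open>z \<in> Y\<close> assms(2)] strong_concavity[OF assms(1) \<open>z \<in> Y\<close> assms(3)]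
  show ?thesis
    unfolding 1 h_def by (simp add: assms(4) blinfun.minus_right power_divide)
qed

text \<open>A concave function lies below its tangent at \<open>y\<close>, so the linear gap
  certifies the distance to the maximal value.\<close>

lemma h_le_linear_gap:
  assumes "x \<in> X" "y \<in> Y" and max: "\<And>v. v \<in> Y \<Longrightarrow> grad_y L x y v \<le> grad_y L x y p"
  shows "h x y \<le> grad_y L x y (p - y)"
proof -
  obtain ym where "ym \<in> Y" "\<phi> x = L x ym"
    using maximizer[OF assms(1)] by metis
  moreover have "0 \<le> \<mu> / 2 * (norm (ym - y))\<^sup>2"
    using \<mu> by simp
  ultimately show ?thesis
    using strong_concavity[OF assms(1,2), of ym] max[of ym] by (simp add: h_def blinfun.diff_right)
qed

text \<open>A Polyak-Lojasiewicz inequality: strong concavity bounds \<open>h\<close> by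
  \<open>g * d - \<mu> / 2 * d\<^sup>2\<close>, which is at most
  \<open>g\<^sup>2 / (2 * \<mu>)\<close> for every \<open>d\<close>.\<close>

lemma h_le_gradient:
  assumes "x \<in> X" "y \<in> Y"
  shows "sqrt (2 * \<mu>) * sqrt (h x y) \<le> norm (grad_y L x y)"
proof -
  obtain ym where ym: "ym \<in> Y" "\<phi> x = L x ym"
    using maximizer[OF assms(1)] by metis
  define d where "d = norm (ym - y)"
  define g where "g = norm (grad_y L x y)"
  have "h x y \<le> g * d - \<mu> / 2 * d\<^sup>2"
    using strong_concavity[OF assms ym(1)] norm_blinfun[of "grad_y L x y" "ym - y"] ym
    by (simp add: h_def g_def d_def)
  then have "2 * \<mu> * h x y \<le> 2 * \<mu> * (g * d - \<mu> / 2 * d\<^sup>2)"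
    using \<mu> by (intro mult_left_mono) auto
  also have "\<dots> = g\<^sup>2 - (g - \<mu> * d)\<^sup>2"
    by (simp add: power2_eq_square algebra_simps)
  finally have "2 * \<mu> * h x y \<le> g\<^sup>2"
    by (smt (verit) zero_le_power2)
  then show ?thesis
    using real_le_lsqrt[of g "2 * \<mu> * h x y"] by (simp add: g_def flip: real_sqrt_mult)
qed

lemma descent_x:
  assumes "x \<in> X" "x' \<in> X" "y \<in> Y"
  shows "\<bar>L x' y - L x y - grad_x L x y (x' - x)\<bar> \<le> Lxx / 2 * (norm (x' - x))\<^sup>2"
  unfolding grad_x_def
  using lip_x[OF _ assms(1) assms(3) assms(3)]
  by (intro descent_lemma[OF convex_X assms(1,2) diff_x[OF assms(3)]]) (simp add: grad_x_def)

text \<open>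
  No Lipschitz bound on the maximizer is needed: the displacement of the maximizer is absorbed
  by quadratic growth at \<open>x\<close>, via AM-GM.
\<close>

lemma primal_step:
  assumes "x \<in> X" "x' \<in> X" "y \<in> Y"
  shows "\<phi> x' \<le> \<phi> x + grad_x L x y (x' - x) + \<kappa> * sqrt (h x y) * norm (x' - x)
           + (\<beta> - Lxx / 2) * (norm (x' - x))\<^sup>2"
proof -
  obtain ym where ym: "ym \<in> Y" "\<phi> x = L x ym"
    using maximizer[OF assms(1)] by metis
  obtain yn where yn: "yn \<in> Y" "\<phi> x' = L x' yn"
    using maximizer[OF assms(2)] by metis
  define n where "n = norm (x' - x)"
  define d where "d = norm (ym - yn)"
  define e where "e = norm (ym - y)"
  have 1: "L x' yn \<le> L x yn + grad_x L x yn (x' - x) + Lxx / 2 * n\<^sup>2"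
    using descent_x[OF assms(1,2) yn(1)] unfolding abs_le_iff by (simp add: n_def)
  have 2: "L x yn \<le> \<phi> x - \<mu> / 4 * d\<^sup>2"
    using quadratic_growth[OF assms(1) yn(1) ym] by (simp add: h_def d_def)
  \<comment> \<open>The value at \<open>x'\<close> is attained at \<open>yn\<close>, but the
    gradient in the claim is taken at \<open>y\<close>. Passing through \<open>ym\<close> splits the
    discrepancy into a part in \<open>d\<close>, to be absorbed by fact 2, and a part in
    \<open>e\<close>, of order \<open>sqrt (h x y)\<close>.\<close>
  have "norm (yn - y) \<le> d + e"
    unfolding d_def e_def by norm
  then have "Lyx * norm (yn - y) \<le> Lyx * (d + e)"
    using Lyx by (intro mult_left_mono) auto
  then have "norm (grad_x L x yn - grad_x L x y) \<le> Lyx * (d + e)"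
    using lip_x[OF assms(1,1) yn(1) assms(3)] by simp
  then have "norm (grad_x L x yn - grad_x L x y) * n \<le> Lyx * (d + e) * n"
    by (rule mult_right_mono) (simp add: n_def)
  then have 3: "grad_x L x yn (x' - x) \<le> grad_x L x y (x' - x) + Lyx * d * n + Lyx * e * n"
    using norm_blinfun[of "grad_x L x yn - grad_x L x y" "x' - x"]
    by (simp add: n_def blinfun.diff_left algebra_simps)
  \<comment> \<open>The weights give \<open>d\<^sup>2\<close> the coefficient
    \<open>\<mu> / 4\<close>, which fact 2 cancels exactly.\<close>
  have "0 \<le> (sqrt \<mu> / 2 * d - Lyx / sqrt \<mu> * n)\<^sup>2"
    by simp
  also have "\<dots> = \<mu> / 4 * d\<^sup>2 - Lyx * d * n + Lyx\<^sup>2 / \<mu> * n\<^sup>2"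
    using \<mu> by (simp add: power2_diff power_mult_distrib power_divide)
  finally have 4: "Lyx * d * n \<le> \<mu> / 4 * d\<^sup>2 + Lyx\<^sup>2 / \<mu> * n\<^sup>2"
    by simp
  have "sqrt (\<mu> / 4 * e\<^sup>2) \<le> sqrt (h x y)"
    using quadratic_growth[OF assms(1,3) ym] by (intro real_sqrt_le_mono) (simp add: e_def)
  then have "e \<le> 2 / sqrt \<mu> * sqrt (h x y)"
    using \<mu> by (simp add: real_sqrt_mult real_sqrt_divide e_def field_simps)
  then have "Lyx * e * n \<le> Lyx * (2 / sqrt \<mu> * sqrt (h x y)) * n"
    using Lyx by (intro mult_right_mono mult_left_mono) (auto simp: n_def)
  then have "Lyx * e * n \<le> \<kappa> * sqrt (h x y) * n"
    by (simp add: \<kappa>_def mult_ac)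
  with 1 2 3 4 show ?thesis
    unfolding yn(2) by (simp add: n_def[symmetric] \<beta>_def algebra_simps)
qed

text \<open>Both \<phi> and \<open>L\<close> at fixed \<open>y\<close> are expanded with the same
  gradient at \<open>(x, y)\<close>, so the first-order terms cancel for any choice of
  \<open>x'\<close>.\<close>

lemma h_primal_step:
  assumes "x \<in> X" "x' \<in> X" "y \<in> Y"
  shows "h x' y \<le> h x y + \<kappa> * sqrt (h x y) * norm (x' - x) + \<beta> * (norm (x' - x))\<^sup>2"
  using primal_step[OF assms] descent_x[OF assms] unfolding abs_le_iff by (simp add: h_def algebra_simps)

text \<open>The step-size rule is made for this: \<open>\<sigma> * Lyy\<close> is at most
  \<open>\<alpha> / 4\<close> times the gradient norm, so by strong convexity of \<open>Y\<close>
  the quadratic error consumes at most half of the first-order gain.\<close>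

lemma h_dual_step:
  assumes "x \<in> X" "y \<in> Y" "p \<in> Y" and max: "\<And>v. v \<in> Y \<Longrightarrow> grad_y L x y v \<le> grad_y L x y p"
    and \<sigma>: "\<sigma> = min 1 (\<alpha> / (4 * Lyy) * norm (grad_y L x y))"
  shows "h x (\<sigma> *\<^sub>R p + (1 - \<sigma>) *\<^sub>R y) \<le> h x y - \<sigma> / 2 * grad_y L x y (p - y)"
proof -
  define y' where "y' = \<sigma> *\<^sub>R p + (1 - \<sigma>) *\<^sub>R y"
  define n where "n = norm (p - y)"
  have "0 \<le> \<sigma>" "\<sigma> \<le> 1"
    using \<sigma> \<alpha> Lyy by auto
  then have "y' \<in> Y"
    using convexD[OF convex_Y assms(3,2)] by (simp add: y'_def)
  have y': "y' - y = \<sigma> *\<^sub>R (p - y)"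
    by (simp add: y'_def algebra_simps)
  have "\<bar>L x y' - L x y - grad_y L x y (y' - y)\<bar> \<le> Lyy / 2 * (norm (y' - y))\<^sup>2"
    unfolding grad_y_def using lip_y[OF assms(1,1) _ assms(2)]
    by (intro descent_lemma[OF convex_Y assms(2) \<open>y' \<in> Y\<close> diff_y[OF assms(1)]]) (simp add: grad_y_def)
  then have 1: "L x y + \<sigma> * grad_y L x y (p - y) - \<sigma> * (\<sigma> * Lyy / 2 * n\<^sup>2) \<le> L x y'"
    unfolding y' abs_le_iff
    by (simp add: blinfun.scaleR_right n_def power_mult_distrib power2_eq_square[of \<sigma>] mult_ac)
  have "\<sigma> * Lyy \<le> \<alpha> / (4 * Lyy) * norm (grad_y L x y) * Lyy"
    using \<sigma> Lyy by (intro mult_right_mono) auto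
  then have "\<sigma> * Lyy \<le> \<alpha> / 4 * norm (grad_y L x y)"
    using Lyy by simp
  then have "\<sigma> * Lyy * n\<^sup>2 \<le> \<alpha> / 4 * norm (grad_y L x y) * n\<^sup>2"
    by (rule mult_right_mono) simp
  also have "\<dots> \<le> grad_y L x y (p - y)"
    unfolding n_def by (rule strongly_convex_set_linear_gap[OF strongly_convex \<alpha> assms(3,2) max])
  finally have "\<sigma> * (\<sigma> * Lyy / 2 * n\<^sup>2) \<le> \<sigma> * (grad_y L x y (p - y) / 2)"
    using \<open>0 \<le> \<sigma>\<close> by (intro mult_left_mono) auto
  with 1 show ?thesis
    unfolding h_def y'_def[symmetric] by simp
qed

section \<open>Gap bounds along a run\<close>

lemma rpdcg_run_gaps:
  assumes c: "0 < c" "c \<le> 1" and x0: "x0 \<in> X" and y0: "y0 \<in> Y"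
  obtains C where "C \<ge> 1"
    "\<And>K x y. 2 \<le> K \<Longrightarrow> rpdcg_run L X Y x0 y0 \<alpha> Lyy c K x y \<Longrightarrow>
      \<exists>t\<in>{nat \<lceil>real K / 2\<rceil>..K - 1}. x t \<in> X \<and> y t \<in> Y \<and>
         gap_X L X (x t) (y t) \<le> C * real K powr (-1/4) \<and>
         gap_Y L Y (x t) (y t) \<le> C * real K powr (-1/2)"
proof -
  obtain Mx where Mx: "Mx > 0" "\<And>x y. x \<in> X \<Longrightarrow> y \<in> Y \<Longrightarrow> norm (grad_x L x y) \<le> Mx"
    by (rule lipschitz_product_bounded[of X Y Lxx Lyx "grad_x L"])
      (use lip_x Lxx Lyx compact_X compact_Y in \<open>auto simp: compact_imp_bounded dist_norm\<close>)
  obtain My where My: "My > 0" "\<And>x y. x \<in> X \<Longrightarrow> y \<in> Y \<Longrightarrow> norm (grad_y L x y) \<le> My"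
    by (rule lipschitz_product_bounded[of X Y Lyx Lyy "grad_y L"])
      (use lip_y Lyx Lyy compact_X compact_Y in \<open>auto simp: compact_imp_bounded dist_norm\<close>)
  define DX where "DX = diameter X"
  define DY where "DY = diameter Y + 1"
  have DX: "norm (u - v) \<le> DX" if "u \<in> X" "v \<in> X" for u v
    using diameter_bounded_bound[OF compact_imp_bounded[OF compact_X] that] by (simp add: DX_def dist_norm)
  have DY: "norm (u - v) \<le> DY" if "u \<in> Y" "v \<in> Y" for u v
    using diameter_bounded_bound[OF compact_imp_bounded[OF compact_Y] that] by (simp add: DY_def dist_norm)
  have "DX \<ge> 0" "DY > 0"
    using DX[OF x0 x0] DY[OF y0 y0] diameter_ge_0[OF compact_imp_bounded[OF compact_Y]]
    by (simp_all add: DY_def)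
  \<comment> \<open>\<open>q\<close> serves both branches of the minimum: \<open>\<sigma>\<close> is
    at least \<open>q\<close> times the gradient norm, as that norm is at most \<open>My\<close>.
    \<open>R\<close> will bound \<open>sqrt h\<close>, and \<open>b\<close> is scaled to give
    \<open>4 * b * sqrt h \<le> \<sigma>\<close>.\<close>
  define q where "q = min (1 / My) (\<alpha> / (4 * Lyy))"
  define R where "R = My / sqrt (2 * \<mu>)"
  define b where "b = q * sqrt (2 * \<mu>) / 4"
  define E where "E = DX * (\<kappa> + \<beta> + 1)"
  define C1 where "C1 = (4 * R + 2 * E + 1) / b + 1"
  define C2 where "C2 = C1 + E"
  \<comment> \<open>\<open>N0 / K\<close> will bound the error of one late iteration and
    \<open>V0\<close> the total drop of the potential; the 4 in \<open>V\<close> reflects a window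
    of at least \<open>K / 4\<close> iterations.\<close>
  define N0 where "N0 = 2 * \<kappa> * DX * C2 + 2 * \<beta> * DX\<^sup>2"
  define V0 where "V0 = R\<^sup>2 + Mx * DX + \<kappa> * R * DX + \<beta> * DX\<^sup>2"
  define V where "V = 4 * (V0 + N0)"
  define C where "C = 1 + V / c + sqrt (2 * V * DY / q)"
  have pos: "q > 0" "R > 0" "b > 0" "E \<ge> 0"
    using My \<alpha> Lyy \<mu> \<kappa>_nonneg \<beta>_nonneg \<open>DX \<ge> 0\<close> by (simp_all add: q_def R_def b_def E_def)
  then have C1: "C1 \<ge> 1"
    by (simp add: C1_def)
  have "N0 \<ge> 0" "V0 \<ge> 0" "C2 \<ge> 0"
    using pos C1 \<kappa>_nonneg \<beta>_nonneg \<open>DX \<ge> 0\<close> Mx(1) by (simp_all add: N0_def V0_def C2_def)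
  then have "V \<ge> 0"
    by (simp add: V_def)
  then have "C \<ge> 1"
    using pos c \<open>DY > 0\<close> by (simp add: C_def)
  moreover have "\<exists>t\<in>{nat \<lceil>real K / 2\<rceil>..K - 1}. x t \<in> X \<and> y t \<in> Y \<and>
         gap_X L X (x t) (y t) \<le> C * real K powr (-1/4) \<and>
         gap_Y L Y (x t) (y t) \<le> C * real K powr (-1/2)"
    if K: "2 \<le> K" and run: "rpdcg_run L X Y x0 y0 \<alpha> Lyy c K x y" for K x y
  proof -
    \<comment> \<open>All rates become powers of \<open>w\<close>: the primal step is
      \<open>c * w ^ 3\<close>, the gaps are of order \<open>w\<close> and \<open>w\<^sup>2\<close>,
      and \<open>K * w ^ 4 = 1\<close>.\<close>
    define w where "w = real K powr (-1/4)"
    define \<tau> where "\<tau> = c * w ^ 3"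
    define m where "m = nat \<lceil>real K / 2\<rceil>"
    have "w ^ 4 = 1 / real K"
      using K by (simp add: w_def powr_power powr_neg_one)
    then have w: "w > 0" "real K * w ^ 4 = 1" "w \<le> 1"
      using K powr_mono[of "-1/4" 0 "real K"] by (simp_all add: w_def)
    have w2: "real K powr (-1/2) = w\<^sup>2" and w3: "real K powr (-3/4) = w ^ 3"
      using K by (simp_all add: w_def powr_power)
    have "\<tau> \<le> w ^ 3" "w ^ 3 \<le> 1"
      using c w power_le_one[of w 3] mult_left_le_one_le[of "w ^ 3" c] by (auto simp: \<tau>_def)
    moreover have "0 < \<tau>"
      using c w by (simp add: \<tau>_def)
    ultimately have \<tau>: "0 < \<tau>" "\<tau> \<le> w ^ 3" "\<tau> \<le> 1"
      by simp_all
    \<comment> \<open>Rounding up leaves \<open>K - m \<ge> (K - 1) / 2\<close>, which is at least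
      \<open>K / 4\<close> because \<open>K \<ge> 2\<close>.\<close>
    have "real K / 2 \<le> real m" "real m < real K / 2 + 1"
      unfolding m_def by linarith+
    moreover from this(2) have "2 * m \<le> K + 1"
      by linarith
    ultimately have m: "real K / 2 \<le> real m" "m < K" "real K / 4 \<le> real (K - m)"
      using K by linarith+
    define \<sigma> where "\<sigma> k = min 1 (\<alpha> / (4 * Lyy) * norm (grad_y L (x k) (y k)))" for k
    from run obtain s p where
      init: "x 0 = x0" "y 0 = y0" and
      s: "\<And>k. s k \<in> X" "\<And>k u. u \<in> X \<Longrightarrow> grad_x L (x k) (y k) (s k) \<le> grad_x L (x k) (y k) u" and
      xS: "\<And>k. x (Suc k) = \<tau> *\<^sub>R s k + (1 - \<tau>) *\<^sub>R x k" and
      p: "\<And>k. p k \<in> Y" "\<And>k v. v \<in> Y \<Longrightarrow> grad_y L (x k) (y k) v \<le> grad_y L (x k) (y k) (p k)" and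
      yS: "\<And>k. y (Suc k) = \<sigma> k *\<^sub>R p k + (1 - \<sigma> k) *\<^sub>R y k"
      unfolding rpdcg_run_def rpdcg_def is_arg_min_def is_arg_max_def w3 \<tau>_def[symmetric] \<sigma>_def[symmetric]
      by (metis linorder_not_less)
    have \<sigma>01: "0 \<le> \<sigma> k" "\<sigma> k \<le> 1" for k
      using \<alpha> Lyy by (auto simp: \<sigma>_def)
    have xX: "x k \<in> X" for k
    proof (induction k)
      case (Suc k)
      then show ?case
        unfolding xS using \<tau> s(1) by (intro convexD[OF convex_X]) auto
    qed (simp add: init x0)
    have yY: "y k \<in> Y" for k
    proof (induction k)
      case (Suc k)
      then show ?case
        unfolding yS using \<sigma>01 p(1) by (intro convexD[OF convex_Y]) auto
    qed (simp add: init y0)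
    define G where "G k = grad_x L (x k) (y k) (x k - s k)" for k
    define g where "g k = grad_y L (x k) (y k) (p k - y k)" for k
    have gapX: "gap_X L X (x k) (y k) = G k" for k
      unfolding gap_X_def G_def using s
      by (intro cSup_eq_maximum) (auto simp: blinfun.diff_right)
    have gapY: "gap_Y L Y (x k) (y k) = g k" for k
      unfolding gap_Y_def g_def using p
      by (intro cSup_eq_maximum) (auto simp: blinfun.diff_right)
    have G0: "0 \<le> G k" and g0: "0 \<le> g k" for k
      using s(2)[OF xX] p(2)[OF yY] by (simp_all add: G_def g_def blinfun.diff_right)
    have \<sigma>q: "q * norm (grad_y L (x k) (y k)) \<le> \<sigma> k" for k
    proof -
      let ?n = "norm (grad_y L (x k) (y k))"
      have "q * ?n \<le> 1 / My * ?n" "q * ?n \<le> \<alpha> / (4 * Lyy) * ?n"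
        by (intro mult_right_mono; simp add: q_def)+
      moreover have "1 / My * ?n \<le> 1"
        using My(1) My(2)[OF xX yY] by simp
      ultimately show ?thesis
        by (simp add: \<sigma>_def)
    qed
    have \<delta>: "norm (x (Suc k) - x k) \<le> DX * \<tau>" for k
    proof -
      have "x (Suc k) - x k = \<tau> *\<^sub>R (s k - x k)"
        unfolding xS by (simp add: algebra_simps)
      then show ?thesis
        using \<tau> DX[OF s(1) xX, of k k] by (simp add: mult.commute)
    qed
    have \<delta>2: "(norm (x (Suc k) - x k))\<^sup>2 \<le> DX\<^sup>2 * \<tau>\<^sup>2" for k
      using power_mono[OF \<delta>, of k 2] by (simp add: power_mult_distrib)
    define r where "r k = sqrt (h (x k) (y k))" for k
    \<comment> \<open>The algorithm updates both variables simultaneously; the analysis inserts the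
      intermediate pair with the new \<open>y\<close> and the old \<open>x\<close>, so that dual
      progress and primal drift are estimated one after the other.\<close>
    define r' where "r' k = sqrt (h (x k) (y (Suc k)))" for k
    have hr: "h (x k) (y k) = (r k)\<^sup>2" "h (x k) (y (Suc k)) = (r' k)\<^sup>2" for k
      using h_nonneg[OF xX yY] by (simp_all add: r_def r'_def)
    have r0: "0 \<le> r k" "0 \<le> r' k" for k
      using h_nonneg[OF xX yY] by (simp_all add: r_def r'_def)
    have rgrad: "sqrt (2 * \<mu>) * r k \<le> norm (grad_y L (x k) (y k))" for k
      unfolding r_def by (rule h_le_gradient[OF xX yY])
    have rR: "r k \<le> R" for k
      using rgrad[of k] My(2)[OF xX yY, of k k] \<mu> by (simp add: R_def field_simps)
    have dual: "(r' k)\<^sup>2 \<le> (r k)\<^sup>2 - \<sigma> k / 2 * g k" for k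
    proof -
      have "h (x k) (y (Suc k)) \<le> h (x k) (y k) - \<sigma> k / 2 * g k"
        unfolding yS g_def by (rule h_dual_step[OF xX yY p(1) _ \<sigma>_def]) (rule p(2))
      then show ?thesis
        by (simp only: hr)
    qed
    have r'r: "r' k \<le> r k" for k
    proof (rule power2_le_imp_le)
      have "0 \<le> \<sigma> k / 2 * g k"
        using \<sigma>01 g0 by simp
      then show "(r' k)\<^sup>2 \<le> (r k)\<^sup>2"
        using dual[of k] by linarith
    qed (rule r0)
    \<comment> \<open>The bound \<open>(r k)\<^sup>2 \<le> g k\<close> and
      \<open>4 * b * r k \<le> \<sigma> k\<close> turn the dual decrease into a cubic term, which is
      completed to a square. Since \<open>\<sigma> k \<le> 1\<close>, the base of that square is
      nonnegative and the root can be taken.\<close>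
    have r': "r' k \<le> r k - b * (r k)\<^sup>2" for k
    proof -
      have "4 * b * r k = q * (sqrt (2 * \<mu>) * r k)"
        by (simp add: b_def)
      also have "\<dots> \<le> q * norm (grad_y L (x k) (y k))"
        using rgrad pos by (intro mult_left_mono) auto
      also have "\<dots> \<le> \<sigma> k"
        by (rule \<sigma>q)
      finally have 4: "4 * b * r k \<le> \<sigma> k" .
      have "(r k)\<^sup>2 \<le> g k"
        unfolding g_def hr[symmetric] by (rule h_le_linear_gap[OF xX yY p(2)])
      then have "4 * b * r k * (r k)\<^sup>2 \<le> \<sigma> k * g k"
        using 4 \<sigma>01 by (intro mult_mono) auto
      then have "(r' k)\<^sup>2 \<le> (r k)\<^sup>2 - 2 * b * r k * (r k)\<^sup>2 + (b * (r k)\<^sup>2)\<^sup>2"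
        using dual[of k] zero_le_power2[of "b * (r k)\<^sup>2"] by linarith
      also have "\<dots> = (r k - b * (r k)\<^sup>2)\<^sup>2"
        by (simp add: power2_eq_square algebra_simps)
      finally have "(r' k)\<^sup>2 \<le> (r k - b * (r k)\<^sup>2)\<^sup>2" .
      moreover have "0 \<le> r k * (1 - b * r k)"
        using 4 \<sigma>01[of k] r0[of k] by (intro mult_nonneg_nonneg) linarith+
      then have "0 \<le> r k - b * (r k)\<^sup>2"
        by (simp add: power2_eq_square algebra_simps)
      ultimately show ?thesis
        by (rule power2_le_imp_le)
    qed
    have hS: "(r (Suc k))\<^sup>2 \<le> (r' k)\<^sup>2 + \<kappa> * DX * \<tau> * r' k + \<beta> * DX\<^sup>2 * \<tau>\<^sup>2" for k
    proof -
      have "\<kappa> * r' k * norm (x (Suc k) - x k) \<le> \<kappa> * r' k * (DX * \<tau>)"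
        using \<delta> \<kappa>_nonneg r0 by (intro mult_left_mono) auto
      moreover have "\<beta> * (norm (x (Suc k) - x k))\<^sup>2 \<le> \<beta> * (DX\<^sup>2 * \<tau>\<^sup>2)"
        using \<delta>2 \<beta>_nonneg by (intro mult_left_mono) auto
      ultimately show ?thesis
        using h_primal_step[of "x k" "x (Suc k)" "y (Suc k)", OF xX xX yY, unfolded hr] r0(2)[of k]
        by (simp add: mult_ac)
    qed
    \<comment> \<open>The primal drift is majorized by the square of
      \<open>r' k + E * \<tau>\<close>; the 1 in \<open>E\<close> ensures
      \<open>\<beta> \<le> (\<kappa> + \<beta> + 1)\<^sup>2\<close>.\<close>
    have rS: "r (Suc k) \<le> r k - b * (r k)\<^sup>2 + E * \<tau>" for k
    proof -
      have "\<kappa> * DX * \<tau> * r' k \<le> 2 * E * \<tau> * r' k"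
        using \<kappa>_nonneg \<beta>_nonneg \<open>DX \<ge> 0\<close> \<tau> r0(2)[of k]
        by (intro mult_right_mono) (auto simp: E_def algebra_simps)
      moreover have "\<beta> \<le> (\<kappa> + \<beta> + 1)\<^sup>2"
        using \<kappa>_nonneg \<beta>_nonneg by (simp add: power2_eq_square algebra_simps)
      then have "\<beta> * DX\<^sup>2 * \<tau>\<^sup>2 \<le> (\<kappa> + \<beta> + 1)\<^sup>2 * DX\<^sup>2 * \<tau>\<^sup>2"
        by (intro mult_right_mono) auto
      then have "\<beta> * DX\<^sup>2 * \<tau>\<^sup>2 \<le> (E * \<tau>)\<^sup>2"
        by (simp add: E_def power_mult_distrib mult_ac)
      ultimately have "(r (Suc k))\<^sup>2 \<le> (r' k + E * \<tau>)\<^sup>2"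
        using hS[of k] by (simp add: power2_sum mult_ac)
      then have "r (Suc k) \<le> r' k + E * \<tau>"
        by (rule power2_le_imp_le) (use r0 pos \<tau> in auto)
      then show ?thesis
        using r'[of k] by simp
    qed
    have E\<tau>: "E * \<tau> \<le> E * w\<^sup>2" "E * \<tau> \<le> E * w"
    proof -
      have "w ^ 3 \<le> w\<^sup>2" "w ^ 3 \<le> w ^ 1"
        using w by (intro power_decreasing; simp)+
      then show "E * \<tau> \<le> E * w\<^sup>2" "E * \<tau> \<le> E * w"
        using \<tau> pos by (intro mult_left_mono; simp)+
    qed
    \<comment> \<open>At level \<open>C1 * w\<close> the quadratic decrease exceeds the error; of
      the \<open>2 * E\<close> in \<open>C1\<close>, one \<open>E\<close> is spent on
      \<open>E * \<tau>\<close>.\<close>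
    have C1w: "(4 * R + 1 + E) * w\<^sup>2 \<le> b * (C1 * w)\<^sup>2 - E * \<tau>"
    proof -
      have "4 * R + 2 * E + 1 \<le> b * C1"
        using pos by (simp add: C1_def field_simps)
      also have "\<dots> \<le> b * C1\<^sup>2"
        using pos C1 by (simp add: power2_eq_square)
      finally have "(4 * R + 2 * E + 1) * w\<^sup>2 \<le> b * C1\<^sup>2 * w\<^sup>2"
        by (intro mult_right_mono) auto
      then show ?thesis
        using E\<tau> by (simp add: power_mult_distrib algebra_simps)
    qed
    have rw: "r k \<le> C2 * w" if "m \<le> k" for k
    proof -
      have "0 \<le> (4 * R + 1) * w\<^sup>2" "(4 * R + 1) * w\<^sup>2 \<le> (4 * R + 1 + E) * w\<^sup>2"
        using pos by (simp_all add: mult_right_mono)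
      then have Ew: "0 \<le> (4 * R + 1) * w\<^sup>2" "(4 * R + 1) * w\<^sup>2 \<le> b * (C1 * w)\<^sup>2 - E * \<tau>"
          "E * \<tau> \<le> b * (C1 * w)\<^sup>2"
        using C1w by linarith+
      \<comment> \<open>The first \<open>m \<ge> K / 2\<close> iterations suffice to reach level
        \<open>C1 * w\<close>, since \<open>K * w\<^sup>2 \<ge> K * w ^ 4 = 1\<close>.\<close>
      have "R < (4 * R + 1) / 2 * (real K * w ^ 4)"
        using w pos by simp
      also have "\<dots> \<le> (4 * R + 1) / 2 * (real K * w\<^sup>2)"
        using w pos power_decreasing[of 2 4 w] by (intro mult_left_mono) auto
      also have "\<dots> = real K / 2 * ((4 * R + 1) * w\<^sup>2)"
        by simp
      also have "\<dots> \<le> real m * (b * (C1 * w)\<^sup>2 - E * \<tau>)"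
        by (rule mult_mono) (use m(1) Ew in simp_all)
      finally have Rm: "R < real m * (b * (C1 * w)\<^sup>2 - E * \<tau>)" .
      have "r k \<le> C1 * w + E * \<tau>"
        by (rule quadratic_drift_bound[where r = r, OF r0(1) rR rS _ _ _ Ew(3) Rm that]) (use pos C1 w \<tau> in simp_all)
      then show ?thesis
        using E\<tau> by (simp add: C2_def algebra_simps)
    qed
    have \<phi>S: "\<phi> (x (Suc k)) \<le> \<phi> (x k) - \<tau> * G k + \<kappa> * DX * \<tau> * r k + \<beta> * DX\<^sup>2 * \<tau>\<^sup>2" for k
    proof -
      have "\<kappa> * r k * norm (x (Suc k) - x k) \<le> \<kappa> * r k * (DX * \<tau>)"
        using \<delta> \<kappa>_nonneg r0 by (intro mult_left_mono) auto
      moreover have "(\<beta> - Lxx / 2) * (norm (x (Suc k) - x k))\<^sup>2 \<le> \<beta> * (DX\<^sup>2 * \<tau>\<^sup>2)"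
        using \<delta>2 \<beta>_nonneg Lxx by (intro mult_mono) auto
      moreover have "x (Suc k) - x k = - (\<tau> *\<^sub>R (x k - s k))"
        unfolding xS by (simp add: algebra_simps)
      then have "grad_x L (x k) (y k) (x (Suc k) - x k) = - (\<tau> * G k)"
        by (simp add: G_def blinfun.minus_right blinfun.scaleR_right)
      ultimately show ?thesis
        using primal_step[of "x k" "x (Suc k)" "y k", OF xX xX yY] by (simp add: r_def mult_ac)
    qed
    \<comment> \<open>The first term supplies the dual gap and the second the primal gap. Each
      incurs an error of order \<open>\<tau> * r k + \<tau>\<^sup>2\<close>, hence the factors 2 in
      \<open>N0\<close>; the late bound on \<open>r\<close> makes it
      \<open>O(w ^ 4)\<close>.\<close>
    define \<Psi> where "\<Psi> k = (r k)\<^sup>2 + \<phi> (x k)" for k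
    have "\<Psi> (Suc k) \<le> \<Psi> k - (\<sigma> k / 2 * g k + \<tau> * G k) + N0 * w ^ 4" if "m \<le> k" for k
    proof -
      have "\<tau> * r k \<le> w ^ 3 * (C2 * w)"
        using \<tau> w rw[OF that] r0 by (intro mult_mono) auto
      then have \<tau>r: "\<tau> * r k \<le> C2 * w ^ 4"
        by (simp add: numeral_eq_Suc mult_ac)
      have "\<tau>\<^sup>2 \<le> (w ^ 3)\<^sup>2"
        using \<tau> by (intro power_mono) auto
      also have "\<dots> \<le> w ^ 4"
        using w power_decreasing[of 4 6 w] by (simp flip: power_mult)
      finally have \<tau>2: "\<beta> * DX\<^sup>2 * \<tau>\<^sup>2 \<le> \<beta> * DX\<^sup>2 * w ^ 4"
        using \<beta>_nonneg by (intro mult_left_mono) auto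
      have "\<kappa> * DX * \<tau> * r' k \<le> \<kappa> * DX * \<tau> * r k"
        using r'r \<kappa>_nonneg \<open>DX \<ge> 0\<close> \<tau> by (intro mult_left_mono) auto
      moreover have "\<kappa> * DX * (\<tau> * r k) \<le> \<kappa> * DX * (C2 * w ^ 4)"
        using \<tau>r \<kappa>_nonneg \<open>DX \<ge> 0\<close> by (intro mult_left_mono) auto
      ultimately show ?thesis
        using hS[of k] \<phi>S[of k] dual[of k] \<tau>2 by (simp add: \<Psi>_def N0_def algebra_simps)
    qed
    then obtain t where t: "t \<in> {m..K - 1}"
      "real (K - m) * (\<sigma> t / 2 * g t + \<tau> * G t) \<le> \<Psi> m - \<Psi> K + real (K - m) * (N0 * w ^ 4)"
      by (rule telescoping_average[OF _ m(2)])
    \<comment> \<open>\<open>primal_step\<close> is applied in one leap from \<open>x K\<close> to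
      \<open>x m\<close>, which bounds the difference of \<phi> by diameters and gradient bounds
      alone.\<close>
    have "\<Psi> m - \<Psi> K \<le> V0"
    proof -
      define d where "d = norm (x m - x K)"
      have d: "0 \<le> d" "d \<le> DX"
        using DX[OF xX xX] by (simp_all add: d_def)
      have "grad_x L (x K) (y K) (x m - x K) \<le> norm (grad_x L (x K) (y K)) * d"
        using norm_blinfun[of "grad_x L (x K) (y K)" "x m - x K"] by (simp add: d_def)
      also have "\<dots> \<le> Mx * DX"
        using Mx xX yY d by (intro mult_mono) auto
      finally have "grad_x L (x K) (y K) (x m - x K) \<le> Mx * DX" .
      moreover have "\<kappa> * r K * d \<le> \<kappa> * R * DX"
        using \<kappa>_nonneg r0 rR d pos by (intro mult_mono) auto
      moreover have "(\<beta> - Lxx / 2) * d\<^sup>2 \<le> \<beta> * DX\<^sup>2"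
        using \<beta>_nonneg Lxx d by (intro mult_mono power_mono) auto
      moreover have "(r m)\<^sup>2 \<le> R\<^sup>2" "0 \<le> (r K)\<^sup>2"
        using rR r0 by (auto intro: power_mono)
      ultimately show ?thesis
        using primal_step[of "x K" "x m" "y K", OF xX xX yY, unfolded r_def[symmetric] d_def[symmetric]]
        unfolding \<Psi>_def V0_def by linarith
    qed
    define Z where "Z = \<sigma> t / 2 * g t + \<tau> * G t"
    have "0 \<le> \<sigma> t / 2 * g t" "0 \<le> \<tau> * G t"
      using \<sigma>01 g0 G0 \<tau> by simp_all
    have ZV: "Z \<le> V * w ^ 4"
    proof -
      have "real K / 4 * Z \<le> real (K - m) * Z"
        using m(3) \<open>0 \<le> \<sigma> t / 2 * g t\<close> \<open>0 \<le> \<tau> * G t\<close> by (intro mult_right_mono) (auto simp: Z_def)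
      also have "\<dots> \<le> V0 + real (K - m) * (N0 * w ^ 4)"
        using t(2) \<open>\<Psi> m - \<Psi> K \<le> V0\<close> by (simp add: Z_def)
      also have "\<dots> \<le> V0 + real K * (N0 * w ^ 4)"
        using \<open>N0 \<ge> 0\<close> w by (intro add_left_mono mult_right_mono) auto
      also have "\<dots> = real K / 4 * (V * w ^ 4)"
        using w(2) by (simp add: V_def algebra_simps)
      finally show ?thesis
        using K by simp
    qed
    have "G t \<le> C * w"
    proof -
      have "c * w ^ 3 * G t \<le> V * w ^ 4"
        using ZV \<open>0 \<le> \<sigma> t / 2 * g t\<close> by (simp add: Z_def \<tau>_def)
      then have "w ^ 3 * (c * G t) \<le> w ^ 3 * (V * w)"
        by (simp add: numeral_eq_Suc mult_ac)
      then have "G t \<le> V / c * w"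
        using w c by (simp add: field_simps)
      also have "\<dots> \<le> C * w"
        using w pos \<open>V \<ge> 0\<close> \<open>DY > 0\<close> by (intro mult_right_mono) (auto simp: C_def)
      finally show ?thesis .
    qed
    \<comment> \<open>The gap is at most \<open>DY\<close> times the gradient norm, hence at most
      \<open>DY * \<sigma> t / q\<close>. So a bound on \<open>\<sigma> t * g t\<close> is one on
      the square of the gap.\<close>
    moreover have "g t \<le> C * w\<^sup>2"
    proof -
      let ?n = "norm (grad_y L (x t) (y t))"
      have "g t \<le> ?n * norm (p t - y t)"
        using norm_blinfun[of "grad_y L (x t) (y t)" "p t - y t"] by (simp add: g_def)
      also have "\<dots> \<le> ?n * DY"
        using DY p(1) yY by (intro mult_left_mono) auto
      finally have "q * g t \<le> q * (?n * DY)"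
        using pos by (intro mult_left_mono) auto
      also have "\<dots> = DY * (q * ?n)"
        by simp
      also have "\<dots> \<le> DY * \<sigma> t"
        using \<sigma>q \<open>DY > 0\<close> by (intro mult_left_mono) auto
      finally have "q * g t * g t \<le> DY * \<sigma> t * g t"
        using g0 by (rule mult_right_mono)
      moreover have "\<sigma> t * g t \<le> 2 * V * w ^ 4"
        using ZV \<open>0 \<le> \<tau> * G t\<close> by (simp add: Z_def)
      then have "DY * (\<sigma> t * g t) \<le> DY * (2 * V * w ^ 4)"
        using \<open>DY > 0\<close> by (intro mult_left_mono) auto
      ultimately have "q * (g t)\<^sup>2 \<le> 2 * V * DY * w ^ 4"
        by (simp add: power2_eq_square mult_ac)
      then have "(g t)\<^sup>2 \<le> 2 * V * DY / q * (w\<^sup>2)\<^sup>2"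
        using pos by (simp add: field_simps flip: power_mult)
      then have "g t \<le> sqrt (2 * V * DY / q * (w\<^sup>2)\<^sup>2)"
        by (rule real_le_rsqrt)
      also have "\<dots> = sqrt (2 * V * DY / q) * w\<^sup>2"
        by (simp only: real_sqrt_mult real_sqrt_power[symmetric] real_sqrt_abs abs_power2)
      also have "\<dots> \<le> C * w\<^sup>2"
        using c \<open>V \<ge> 0\<close> by (intro mult_right_mono) (auto simp: C_def)
      finally show ?thesis .
    qed
    ultimately show ?thesis
      using t(1) xX yY unfolding m_def gapX gapY w2 w_def[symmetric] by blast
  qed
  ultimately show ?thesis
    by (rule that)
qed

end

section \<open>From rates to iteration counts\<close>

theorem theorem4p4:
  fixes L :: "'a::real_normed_vector \<Rightarrow> 'b::real_normed_vector \<Rightarrow> real"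
    and X :: "'a set" and Y :: "'b set" and x0 :: 'a and y0 :: 'b
    and Lxx Lyx Lyy \<alpha> \<mu> c :: real
  assumes "finite_dimensional TYPE('a)" and "finite_dimensional TYPE('b)"
    and "Lxx \<ge> 0" and "Lyx > 0" and "Lyy > 0"
    and "\<And>y. y \<in> Y \<Longrightarrow> continuously_differentiable (\<lambda>x. L x y)"
    and "\<And>x x' y y'. x \<in> X \<Longrightarrow> x' \<in> X \<Longrightarrow> y \<in> Y \<Longrightarrow> y' \<in> Y \<Longrightarrow>
           norm (grad_x L x y - grad_x L x' y') \<le> Lxx * norm (x - x') + Lyx * norm (y - y')"
    and "\<And>x. x \<in> X \<Longrightarrow> concave_on Y (\<lambda>y. L x y)"
    and "\<And>x. x \<in> X \<Longrightarrow> continuously_differentiable (\<lambda>y. L x y)"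
    and "\<And>x x' y y'. x \<in> X \<Longrightarrow> x' \<in> X \<Longrightarrow> y \<in> Y \<Longrightarrow> y' \<in> Y \<Longrightarrow>
           norm (grad_y L x y - grad_y L x' y') \<le> Lyx * norm (x - x') + Lyy * norm (y - y')"
    and "X \<noteq> {}" and "convex X" and "compact X"
    and "Y \<noteq> {}" and "convex Y" and "compact Y"
    and "\<alpha> > 0" and "strongly_convex_set \<alpha> Y"
    and "\<mu> > 0" and "\<And>x. x \<in> X \<Longrightarrow> strongly_concave_on \<mu> Y (\<lambda>y. L x y)"
    and "x0 \<in> X" and "y0 \<in> Y" and "0 < c" and "c \<le> 1"
  shows "\<exists>C>0.
    (\<forall>K\<ge>2. \<forall>x y. rpdcg_run L X Y x0 y0 \<alpha> Lyy c K x y \<longrightarrow>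
      (\<exists>t\<in>{nat \<lceil>real K / 2\<rceil>..K - 1}. x t \<in> X \<and> y t \<in> Y \<and>
         gap_X L X (x t) (y t) \<le> C * real K powr (-1/4) \<and>
         gap_Y L Y (x t) (y t) \<le> C * real K powr (-1/2))) \<and>
    (\<forall>\<epsilon>. 0 < \<epsilon> \<and> \<epsilon> < 1 \<longrightarrow>
      (\<forall>K x y. K = nat \<lceil>C * \<epsilon> powr (-4)\<rceil> \<and> rpdcg_run L X Y x0 y0 \<alpha> Lyy c K x y \<longrightarrow>
        (\<exists>t\<in>{nat \<lceil>real K / 2\<rceil>..K - 1}. x t \<in> X \<and> y t \<in> Y \<and>
           gap_X L X (x t) (y t) \<le> C * real K powr (-1/4) \<and>
           gap_Y L Y (x t) (y t) \<le> C * real K powr (-1/2) \<and>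
           gap_X L X (x t) (y t) \<le> \<epsilon>)) \<and>
      (\<forall>K x y. K = nat \<lceil>C * \<epsilon> powr (-2)\<rceil> \<and> rpdcg_run L X Y x0 y0 \<alpha> Lyy c K x y \<longrightarrow>
        (\<exists>t\<in>{nat \<lceil>real K / 2\<rceil>..K - 1}. x t \<in> X \<and> y t \<in> Y \<and>
           gap_X L X (x t) (y t) \<le> C * real K powr (-1/4) \<and>
           gap_Y L Y (x t) (y t) \<le> C * real K powr (-1/2) \<and>
           gap_Y L Y (x t) (y t) \<le> \<epsilon>)))"
proof -
  interpret saddle L X Y Lxx Lyx Lyy \<alpha> \<mu>
    using assms by unfold_locales (auto simp: continuously_differentiable_def)
  obtain C where C: "C \<ge> 1" and gaps:
    "\<And>K x y. 2 \<le> K \<Longrightarrow> rpdcg_run L X Y x0 y0 \<alpha> Lyy c K x y \<Longrightarrow>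
      \<exists>t\<in>{nat \<lceil>real K / 2\<rceil>..K - 1}. x t \<in> X \<and> y t \<in> Y \<and>
         gap_X L X (x t) (y t) \<le> C * real K powr (-1/4) \<and>
         gap_Y L Y (x t) (y t) \<le> C * real K powr (-1/2)"
    using rpdcg_run_gaps assms by metis
  \<comment> \<open>One constant must serve as the rate constant and in both iteration counts. The
    counts require \<open>B \<ge> C ^ 4\<close> and \<open>B \<ge> C\<^sup>2\<close>, and the factor
    2 guarantees \<open>K \<ge> 2\<close>.\<close>
  define B where "B = 2 * C ^ 4"
  have "C \<le> C ^ 4" "C\<^sup>2 \<le> C ^ 4" "1 \<le> C ^ 4"
    using C power_increasing[of 1 4 C] power_increasing[of 2 4 C] by (auto simp: one_le_power)
  then have B: "C \<le> B" "C\<^sup>2 \<le> B" "C ^ 4 \<le> B" "2 \<le> B"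
    by (simp_all add: B_def)
  \<comment> \<open>The sharper bounds with \<open>C\<close> are kept for the same \<open>t\<close>,
    because the bounds with \<open>B\<close> would not give \<epsilon> at
    \<open>K = nat \<lceil>B * \<epsilon> powr (-n)\<rceil>\<close>.\<close>
  have run: "\<exists>t\<in>{nat \<lceil>real K / 2\<rceil>..K - 1}. x t \<in> X \<and> y t \<in> Y \<and>
         gap_X L X (x t) (y t) \<le> B * real K powr (-1/4) \<and>
         gap_Y L Y (x t) (y t) \<le> B * real K powr (-1/2) \<and>
         gap_X L X (x t) (y t) \<le> C * real K powr (-1/4) \<and>
         gap_Y L Y (x t) (y t) \<le> C * real K powr (-1/2)"
    if "2 \<le> K" "rpdcg_run L X Y x0 y0 \<alpha> Lyy c K x y" for K x y
    using gaps[OF that] mult_right_mono[OF \<open>C \<le> B\<close> powr_ge_zero]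
    by (meson order_trans)
  have rate: "2 \<le> nat \<lceil>B * \<epsilon> powr (-n)\<rceil>" "C * real (nat \<lceil>B * \<epsilon> powr (-n)\<rceil>) powr (-1/n) \<le> \<epsilon>"
    if \<epsilon>: "0 < \<epsilon>" "\<epsilon> < 1" and n: "0 < n" "C powr n \<le> B" for \<epsilon> n
  proof -
    have "1 \<le> \<epsilon> powr (-n)"
      using powr_mono'[of "-n" 0 \<epsilon>] \<epsilon> n by simp
    then have "2 * 1 \<le> B * \<epsilon> powr (-n)"
      using B by (intro mult_mono) auto
    then show "2 \<le> nat \<lceil>B * \<epsilon> powr (-n)\<rceil>"
      by linarith
    have "(C / \<epsilon>) powr n \<le> B * \<epsilon> powr (-n)"
      using n C \<epsilon> by (simp add: powr_divide powr_minus_divide divide_right_mono)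
    also have "\<dots> \<le> real (nat \<lceil>B * \<epsilon> powr (-n)\<rceil>)"
      by linarith
    finally have "real (nat \<lceil>B * \<epsilon> powr (-n)\<rceil>) powr (-1/n) \<le> ((C / \<epsilon>) powr n) powr (-1/n)"
      using n C \<epsilon> by (intro powr_mono2') auto
    also have "\<dots> = \<epsilon> / C"
      using n C \<epsilon> by (simp add: powr_powr powr_minus_divide)
    finally show "C * real (nat \<lceil>B * \<epsilon> powr (-n)\<rceil>) powr (-1/n) \<le> \<epsilon>"
      using C by (simp add: field_simps)
  qed
  have 4: "C powr 4 \<le> B" and 2: "C powr 2 \<le> B"
    using B C by (simp_all add: powr_numeral)
  show ?thesis
  proof (intro exI[of _ B] conjI allI impI; (elim conjE)?)
    show "B > 0" using B by simp
  next
    fix K :: nat and x y assume "2 \<le> K" "rpdcg_run L X Y x0 y0 \<alpha> Lyy c K x y"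
    from run[OF this] show "\<exists>t\<in>{nat \<lceil>real K / 2\<rceil>..K - 1}. x t \<in> X \<and> y t \<in> Y \<and>
         gap_X L X (x t) (y t) \<le> B * real K powr (-1/4) \<and>
         gap_Y L Y (x t) (y t) \<le> B * real K powr (-1/2)"
      by blast
  next
    fix \<epsilon> K x y
    assume \<epsilon>: "0 < \<epsilon>" "\<epsilon> < 1" and K: "K = nat \<lceil>B * \<epsilon> powr (-4)\<rceil>"
      and r: "rpdcg_run L X Y x0 y0 \<alpha> Lyy c K x y"
    note R = rate[OF \<epsilon> _ 4, folded K, simplified zero_less_numeral simp_thms]
    from run[OF _ r] R show "\<exists>t\<in>{nat \<lceil>real K / 2\<rceil>..K - 1}. x t \<in> X \<and> y t \<in> Y \<and>
         gap_X L X (x t) (y t) \<le> B * real K powr (-1/4) \<and>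
         gap_Y L Y (x t) (y t) \<le> B * real K powr (-1/2) \<and>
         gap_X L X (x t) (y t) \<le> \<epsilon>"
      by (meson order_trans zero_less_numeral)
  next
    fix \<epsilon> K x y
    assume \<epsilon>: "0 < \<epsilon>" "\<epsilon> < 1" and K: "K = nat \<lceil>B * \<epsilon> powr (-2)\<rceil>"
      and r: "rpdcg_run L X Y x0 y0 \<alpha> Lyy c K x y"
    note R = rate[OF \<epsilon> _ 2, folded K, simplified zero_less_numeral simp_thms]
    from run[OF _ r] R show "\<exists>t\<in>{nat \<lceil>real K / 2\<rceil>..K - 1}. x t \<in> X \<and> y t \<in> Y \<and>
         gap_X L X (x t) (y t) \<le> B * real K powr (-1/4) \<and>
         gap_Y L Y (x t) (y t) \<le> B * real K powr (-1/2) \<and>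
         gap_Y L Y (x t) (y t) \<le> \<epsilon>"
      by (meson order_trans zero_less_numeral)
  qed
qed

end
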